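(* Let $G$ be a graph. (i) $G$ is $2$-$\gamma_{\rm SMB}$-critical if and only if $G$ is isomorphic to $G_n'\cup K_1$ for some $n\ge 1$, or to $G_n''$ for some $n\ge 2$. (ii) $G$ is $2$-$\gamma_{\rm SMB}'$-critical if and only if $G$ is isomorphic to $G_n'$ for some $n\ge 1$.
   Context: Graphs are finite and simple; $\cup$ denotes disjoint union. $G_n'$ is the graph obtained from the complete graph $K_n$ by attaching exactly two pendant vertices (new leaves) to one vertex of $K_n$; $G_n''$ ($n\ge 2$) is obtained from $K_n$ by attaching exactly two pendant vertices to each of two different vertices of $K_n$. The Maker-Breaker domination (MBD) game on a graph $G$ is played by Dominator and Staller, who alternately select previously unselected vertices of $G$. Dominator wins if the set of vertices he has selected becomes a dominating set of $G$; Staller wins if she has selected at least one vertex of every dominating set of $G$ (equivalently, all vertices of some closed neighbourhood $N[v]$). In the D-game Dominator moves first, in the S-game Staller moves first. $\gamma_{\rm SMB}(G)$ (resp. $\gamma_{\rm SMB}'(G)$) is the minimum number $k$ such that Staller has a strategy in the D-game (resp. S-game) guaranteeing that she wins having made at most $k$ moves, whatever Dominator does; it is $\infty$ if Staller has no winning strategy. For $\tau\in\{\gamma_{\rm SMB},\gamma_{\rm SMB}'\}$, $G$ is $k$-$\tau$-critical if $\tau(G)=k$ and $\tau(G)<\tau(G+e)$ for every pair $e$ of nonadjacent distinct vertices of $G$. *)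

theory Defs
  imports "Graph_Theory.Graph_Theory" "HOL-Library.Extended_Nat"
begin

text \<open>
  Finite simple graphs are the \<^locale>\<open>pair_graph\<close>s of Graph_Theory: an undirected edge
  is represented by its two opposite arcs.
\<close>

definition add_edge :: "'a pair_pre_digraph \<Rightarrow> 'a \<Rightarrow> 'a \<Rightarrow> 'a pair_pre_digraph" where
  "add_edge G u v = \<lparr> pverts = pverts G, parcs = parcs G \<union> {(u, v), (v, u)} \<rparr>"

text \<open>The pendant vertex \<open>w\<close> is attached to \<open>v\<close>; to be used with \<open>w\<close> not in \<open>G\<close>.\<close>

definition attach_pendant :: "'a pair_pre_digraph \<Rightarrow> 'a \<Rightarrow> 'a \<Rightarrow> 'a pair_pre_digraph" where
  "attach_pendant G v w =
     \<lparr> pverts = insert w (pverts G), parcs = parcs G \<union> {(v, w), (w, v)} \<rparr>"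

definition disjoint_union ::
    "'a pair_pre_digraph \<Rightarrow> 'b pair_pre_digraph \<Rightarrow> ('a + 'b) pair_pre_digraph" where
  "disjoint_union G H =
     \<lparr> pverts = pverts G <+> pverts H,
       parcs = map_prod Inl Inl ` parcs G \<union> map_prod Inr Inr ` parcs H \<rparr>"

definition complete_graph :: "nat \<Rightarrow> nat pair_pre_digraph" where
  "complete_graph n =
     \<lparr> pverts = {..<n}, parcs = {(u, v). u < n \<and> v < n \<and> u \<noteq> v} \<rparr>"

text \<open>The graphs $G_n'$ (meaningful for $n \ge 1$) and $G_n''$ (meaningful for $n \ge 2$).\<close>

definition graph_one_center :: "nat \<Rightarrow> nat pair_pre_digraph" where
  "graph_one_center n =
     attach_pendant (attach_pendant (complete_graph n) 0 n) 0 (n + 1)"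

definition graph_two_centers :: "nat \<Rightarrow> nat pair_pre_digraph" where
  "graph_two_centers n =
     attach_pendant (attach_pendant
       (attach_pendant (attach_pendant (complete_graph n) 0 n) 0 (n + 1))
       1 (n + 2)) 1 (n + 3)"

definition dominating_set :: "'a pair_pre_digraph \<Rightarrow> 'a set \<Rightarrow> bool" where
  "dominating_set G D \<longleftrightarrow>
     D \<subseteq> pverts G \<and> (\<forall>v \<in> pverts G - D. \<exists>u \<in> D. (u, v) \<in> parcs G)"


section \<open>The Maker-Breaker domination game\<close>

datatype player = Dominator | Staller

fun opponent :: "player \<Rightarrow> player" where
  "opponent Dominator = Staller"
| "opponent Staller = Dominator"

text \<open>
  A play is the list of the vertices selected so far, in chronological order. The parameter
  \<open>first\<close> is the player who starts: \<open>Dominator\<close> in the D-game, \<open>Staller\<close> in the S-game.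
\<close>

definition mover :: "player \<Rightarrow> nat \<Rightarrow> player" where
  "mover first i = (if even i then first else opponent first)"

definition legal_play :: "'a pair_pre_digraph \<Rightarrow> 'a list \<Rightarrow> bool" where
  "legal_play G p \<longleftrightarrow> distinct p \<and> set p \<subseteq> pverts G"

definition selected :: "player \<Rightarrow> player \<Rightarrow> 'a list \<Rightarrow> 'a set" where
  "selected first P p = {p ! i | i. i < length p \<and> mover first i = P}"

text \<open>
  As the selections of the two players are disjoint, Staller can never reach a winning
  position once Dominator's vertices dominate. Letting plays run on after the game has
  been decided is therefore harmless.
\<close>

definition staller_won :: "'a pair_pre_digraph \<Rightarrow> player \<Rightarrow> 'a list \<Rightarrow> bool" where
  "staller_won G first p \<longleftrightarrow>
     (\<forall>D. dominating_set G D \<longrightarrow> selected first Staller p \<inter> D \<noteq> {})"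

text \<open>
  A strategy of Staller maps the play so far to her next move; it has to answer every
  unfinished play in which she is to move with an unselected vertex.
\<close>

definition staller_strategy ::
    "'a pair_pre_digraph \<Rightarrow> player \<Rightarrow> ('a list \<Rightarrow> 'a) \<Rightarrow> bool" where
  "staller_strategy G first \<sigma> \<longleftrightarrow>
     (\<forall>p. legal_play G p \<and> set p \<noteq> pverts G \<and> mover first (length p) = Staller \<longrightarrow>
          \<sigma> p \<in> pverts G - set p)"

definition follows :: "player \<Rightarrow> ('a list \<Rightarrow> 'a) \<Rightarrow> 'a list \<Rightarrow> bool" where
  "follows first \<sigma> p \<longleftrightarrow>
     (\<forall>i < length p. mover first i = Staller \<longrightarrow> p ! i = \<sigma> (take i p))"

text \<open>
  Staller can guarantee to win with at most \<open>k\<close> moves of her own: every complete play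
  consistent with her strategy has an initial part in which she has already won and has
  made at most \<open>k\<close> moves.
\<close>

definition staller_wins_within :: "'a pair_pre_digraph \<Rightarrow> player \<Rightarrow> nat \<Rightarrow> bool" where
  "staller_wins_within G first k \<longleftrightarrow>
     (\<exists>\<sigma>. staller_strategy G first \<sigma> \<and>
        (\<forall>p. legal_play G p \<and> set p = pverts G \<and> follows first \<sigma> p \<longrightarrow>
           (\<exists>i \<le> length p. staller_won G first (take i p) \<and>
              card (selected first Staller (take i p)) \<le> k)))"

text \<open>The infimum of the empty set is \<open>\<infinity>\<close> in \<^typ>\<open>enat\<close>.\<close>

definition staller_number :: "player \<Rightarrow> 'a pair_pre_digraph \<Rightarrow> enat" where
  "staller_number first G = Inf {enat k | k. staller_wins_within G first k}"

definition gamma_SMB :: "'a pair_pre_digraph \<Rightarrow> enat" where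
  "gamma_SMB = staller_number Dominator"

definition gamma_SMB' :: "'a pair_pre_digraph \<Rightarrow> enat" where
  "gamma_SMB' = staller_number Staller"

definition critical ::
    "('a pair_pre_digraph \<Rightarrow> enat) \<Rightarrow> nat \<Rightarrow> 'a pair_pre_digraph \<Rightarrow> bool" where
  "critical \<tau> k G \<longleftrightarrow> \<tau> G = enat k \<and>
     (\<forall>u \<in> pverts G. \<forall>v \<in> pverts G. u \<noteq> v \<and> (u, v) \<notin> parcs G \<longrightarrow>
        \<tau> G < \<tau> (add_edge G u v))"

end

(*
  Staller wins at once if she can select an isolated vertex. Otherwise two moves suffice
  exactly if they can complete the closed neighbourhood of a leaf against every reply, that
  is, if she can start with the centre of a cherry: a vertex x with two leaves a and b. In the
  D-game the first move of Dominator must not spoil all these chances, so there has to be an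
  isolated vertex together with a cherry, or two cherries with different centres. Adding an
  edge between vertices other than the leaves and the isolated vertex involved keeps the win,
  so in a critical graph all remaining vertices form a clique. Conversely, an edge added to
  one of the extremal graphs touches a leaf or the isolated vertex; the only subtle point is
  that in a small clique a non-central clique vertex may itself be a leaf.
*)
theory Submission
  imports Defs
begin

section \<open>Forced wins\<close>

text \<open>Backward induction over positions replaces the quantification over strategies, so that
  short wins become case analyses of a few moves. \<open>k\<close> bounds all of Staller's moves,
  those already in \<open>p\<close> included. The nonemptiness premise of
  \<open>dominator_move\<close> keeps a full board without a win from counting as forced
  vacuously.\<close>

inductive staller_forces :: "'a pair_pre_digraph \<Rightarrow> player \<Rightarrow> nat \<Rightarrow> 'a list \<Rightarrow> bool"
  for G first k where
  won: "staller_won G first p \<Longrightarrow> card (selected first Staller p) \<le> k \<Longrightarrow> staller_forces G first k p"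
| staller_move: "mover first (length p) = Staller \<Longrightarrow> x \<in> pverts G - set p \<Longrightarrow>
    staller_forces G first k (p @ [x]) \<Longrightarrow> staller_forces G first k p"
| dominator_move: "mover first (length p) = Dominator \<Longrightarrow> pverts G - set p \<noteq> {} \<Longrightarrow>
    (\<And>x. x \<in> pverts G - set p \<Longrightarrow> staller_forces G first k (p @ [x])) \<Longrightarrow>
    staller_forces G first k p"

lemma selected_Nil [simp]: "selected first P [] = {}"
  by (simp add: selected_def)

lemma selected_snoc:
  "selected first P (p @ [x]) =
    (if mover first (length p) = P then insert x (selected first P p) else selected first P p)"
proof (intro set_eqI iffI)
  fix y
  assume "y \<in> selected first P (p @ [x])"
  then show "y \<in> (if mover first (length p) = P then insert x (selected first P p)
      else selected first P p)"
    by (auto simp: selected_def nth_append less_Suc_eq split: if_splits)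
next
  fix y
  assume y: "y \<in> (if mover first (length p) = P then insert x (selected first P p)
      else selected first P p)"
  have "\<exists>i < Suc (length p). y = (p @ [x]) ! i \<and> mover first i = P"
  proof (cases "y \<in> selected first P p")
    case True
    then obtain i where "i < length p" "y = p ! i" "mover first i = P"
      by (auto simp: selected_def)
    then show ?thesis by (intro exI[of _ i]) (auto simp: nth_append)
  next
    case False
    then show ?thesis using y by (intro exI[of _ "length p"]) (auto split: if_splits)
  qed
  then show "y \<in> selected first P (p @ [x])" by (auto simp: selected_def)
qed

lemma selected_subset: "selected first P p \<subseteq> set p"
  by (auto simp: selected_def)

lemma finite_selected [simp]: "finite (selected first P p)"
  by (rule finite_subset[OF selected_subset finite_set])

text \<open>Staller moves to a forced position whenever there is one. In a complete play that never
  meets the goal, forcedness would pass from each prefix to the next up to the full board, where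
  only the rule \<open>won\<close> can apply.\<close>

lemma staller_forces_strategy:
  assumes forces: "staller_forces G first k []"
  shows "staller_wins_within G first k"
proof -
  \<comment> \<open>A strategy must answer every legal unfinished position, so an arbitrary free
    vertex is chosen where no move leads to a forced position.\<close>
  define \<sigma> where "\<sigma> p = (if \<exists>x. x \<in> pverts G - set p \<and> staller_forces G first k (p @ [x])
     then SOME x. x \<in> pverts G - set p \<and> staller_forces G first k (p @ [x])
     else SOME x. x \<in> pverts G - set p)" for p
  have good: "\<sigma> p \<in> pverts G - set p \<and> staller_forces G first k (p @ [\<sigma> p])"
    if "\<exists>x. x \<in> pverts G - set p \<and> staller_forces G first k (p @ [x])" for p
    using someI_ex[OF that] that unfolding \<sigma>_def by simp
  have strat: "staller_strategy G first \<sigma>"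
    unfolding staller_strategy_def legal_play_def
  proof (intro allI impI)
    fix p
    assume "(distinct p \<and> set p \<subseteq> pverts G) \<and> set p \<noteq> pverts G \<and> mover first (length p) = Staller"
    then have ex: "\<exists>x. x \<in> pverts G - set p" by blast
    show "\<sigma> p \<in> pverts G - set p"
      using good[of p] someI_ex[OF ex] unfolding \<sigma>_def by presburger
  qed
  have "\<exists>i \<le> length p. staller_won G first (take i p) \<and>
          card (selected first Staller (take i p)) \<le> k"
    if p: "legal_play G p" "set p = pverts G" "follows first \<sigma> p" for p
  proof (rule ccontr)
    assume no: "\<not> ?thesis"
    have "staller_forces G first k (take i p)" if "i \<le> length p" for i
      using that
    proof (induction i)
      case 0
      then show ?case using forces by simp
    next
      case (Suc i)
      then have i: "i < length p" and IH: "staller_forces G first k (take i p)" by auto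
      have step: "take (Suc i) p = take i p @ [p ! i]"
        using i by (simp add: take_Suc_conv_app_nth)
      have "p ! i \<notin> set (take i p)"
        using p(1) i unfolding legal_play_def
        by (metis distinct_take not_distinct_conv_prefix step)
      then have new: "p ! i \<in> pverts G - set (take i p)"
        using i p(2) nth_mem by blast
      from IH show ?case
      proof cases
        case won
        then show ?thesis using no i by auto
      next
        case (staller_move x)
        then have "mover first i = Staller" using i by simp
        then have "p ! i = \<sigma> (take i p)" using p(3) i by (simp add: follows_def)
        then show ?thesis using good[of "take i p"] staller_move step by metis
      next
        case dominator_move
        then show ?thesis using new step by metis
      qed
    qed
    then have "staller_forces G first k p" by (metis order_refl take_all)
    then show False
      using no p(2) by cases (auto dest!: spec[of _ "length p"])
  qed
  then show ?thesis using strat unfolding staller_wins_within_def by blast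
qed

text \<open>By contraposition: if the empty position is not forced, Dominator can keep all positions
  unforced against \<open>\<sigma>\<close>, and the complete play that results is never won within
  \<open>k\<close> moves.\<close>

lemma staller_strategy_forces:
  assumes fin: "finite (pverts G)" and wins: "staller_wins_within G first k"
  shows "staller_forces G first k []"
proof -
  obtain \<sigma> where strat: "staller_strategy G first \<sigma>"
    and win: "\<And>p. legal_play G p \<Longrightarrow> set p = pverts G \<Longrightarrow> follows first \<sigma> p \<Longrightarrow>
      \<exists>i \<le> length p. staller_won G first (take i p) \<and> card (selected first Staller (take i p)) \<le> k"
    using wins unfolding staller_wins_within_def by blast
  \<comment> \<open>The claim is generalised to positions reached under \<open>\<sigma>\<close> that
    are unforced and have no winning prefix; the induction is on the number of free
    vertices.\<close>
  have "False"
    if "legal_play G p" "follows first \<sigma> p" "\<not> staller_forces G first k p"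
      "\<And>i. i \<le> length p \<Longrightarrow> \<not> (staller_won G first (take i p) \<and>
         card (selected first Staller (take i p)) \<le> k)" for p
    using that
  proof (induction "card (pverts G - set p)" arbitrary: p rule: less_induct)
    case less
    have "set p \<noteq> pverts G"
      using win[OF less.prems(1) _ less.prems(2)] less.prems(4) by blast
    then have ne: "pverts G - set p \<noteq> {}"
      using less.prems(1) by (auto simp: legal_play_def)
    \<comment> \<open>From an unforced position every Staller move, in particular that of
      \<open>\<sigma>\<close>, stays unforced, and Dominator has some move that does.\<close>
    obtain x where x: "x \<in> pverts G - set p" "\<not> staller_forces G first k (p @ [x])"
      "mover first (length p) = Staller \<longrightarrow> x = \<sigma> p"
    proof (cases "mover first (length p)")
      case Staller
      then have "\<sigma> p \<in> pverts G - set p"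
        using strat ne less.prems(1) unfolding staller_strategy_def by auto
      then show ?thesis using that staller_move[OF Staller] less.prems(3) by blast
    next
      case Dominator
      then show ?thesis using that dominator_move[OF Dominator ne] less.prems(3) by force
    qed
    have "card (pverts G - set (p @ [x])) < card (pverts G - set p)"
      using x(1) fin by (intro psubset_card_mono) auto
    moreover have "legal_play G (p @ [x])"
      using less.prems(1) x(1) by (auto simp: legal_play_def)
    moreover have "follows first \<sigma> (p @ [x])"
      using less.prems(2) x(3) unfolding follows_def
      by (auto simp: less_Suc_eq nth_append)
    moreover have "\<not> (staller_won G first (take i (p @ [x])) \<and>
         card (selected first Staller (take i (p @ [x]))) \<le> k)" if "i \<le> length (p @ [x])" for i
    proof (cases "i \<le> length p")
      case True
      then show ?thesis using less.prems(4)[of i] by simp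
    next
      case False
      then have "take i (p @ [x]) = p @ [x]" using that by simp
      then show ?thesis using won x(2) by metis
    qed
    ultimately show False using less.hyps x(2) by blast
  qed
  from this[of "[]"] show ?thesis
    using won[of G first "[]" k] by (auto simp: legal_play_def follows_def)
qed

lemma staller_wins_within_iff_forces:
  "finite (pverts G) \<Longrightarrow> staller_wins_within G first k \<longleftrightarrow> staller_forces G first k []"
  using staller_forces_strategy staller_strategy_forces by metis

text \<open>After \<open>k\<close> Staller moves another one would exceed the bound, and Dominator's
  moves leave her set unchanged, so the win must already be there. This cuts off the game tree after
  \<open>k\<close> Staller moves.\<close>

lemma staller_forces_exhausted:
  assumes "staller_forces G first k p"
  shows "card (selected first Staller p) \<le> k \<and>
    (card (selected first Staller p) = k \<longrightarrow> staller_won G first p)"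
  using assms
proof (induction rule: staller_forces.induct)
  case (staller_move p x)
  moreover have "x \<notin> selected first Staller p"
    using staller_move(2) selected_subset by fastforce
  ultimately show ?case
    by (simp add: selected_snoc)
next
  case (dominator_move p)
  then obtain x where "x \<in> pverts G - set p" by blast
  then show ?case
    using dominator_move(1) dominator_move(4)[of x] by (simp add: selected_snoc staller_won_def)
qed simp

section \<open>Closed neighbourhoods and wins in one or two moves\<close>

definition isolated :: "'a pair_pre_digraph \<Rightarrow> 'a \<Rightarrow> bool" where
  "isolated G v \<longleftrightarrow> v \<in> pverts G \<and> (\<forall>u. (v, u) \<notin> parcs G)"

definition leaf :: "'a pair_pre_digraph \<Rightarrow> 'a \<Rightarrow> 'a \<Rightarrow> bool" where
  "leaf G l s \<longleftrightarrow> (l, s) \<in> parcs G \<and> (\<forall>u. (l, u) \<in> parcs G \<longrightarrow> u = s)"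

lemma leaf_iff: "leaf G l s \<longleftrightarrow> (\<forall>u. (l, u) \<in> parcs G \<longleftrightarrow> u = s)"
  unfolding leaf_def by blast

definition cherry :: "'a pair_pre_digraph \<Rightarrow> 'a \<Rightarrow> 'a \<Rightarrow> 'a \<Rightarrow> bool" where
  "cherry G x a b \<longleftrightarrow> leaf G a x \<and> leaf G b x \<and> a \<noteq> b"

definition nbhd :: "'a pair_pre_digraph \<Rightarrow> 'a \<Rightarrow> 'a set" where
  "nbhd G v = insert v {u. (v, u) \<in> parcs G}"

context pair_graph
begin

text \<open>The set to test is the complement of Staller's selection: it dominates unless she holds
  a whole closed neighbourhood. Conversely, a dominating set meets every closed
  neighbourhood.\<close>

lemma staller_won_iff:
  "staller_won G first p \<longleftrightarrow> (\<exists>v \<in> pverts G. nbhd G v \<subseteq> selected first Staller p)"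
proof
  let ?S = "selected first Staller p"
  assume won: "staller_won G first p"
  show "\<exists>v \<in> pverts G. nbhd G v \<subseteq> ?S"
  proof (rule ccontr)
    assume no: "\<not> ?thesis"
    have "\<exists>u \<in> pverts G - ?S. (u, v) \<in> parcs G" if "v \<in> pverts G - (pverts G - ?S)" for v
      using no that arcs_symmetric in_arcsD2 unfolding nbhd_def by blast
    then have "dominating_set G (pverts G - ?S)"
      unfolding dominating_set_def by blast
    then show False using won unfolding staller_won_def by blast
  qed
next
  assume "\<exists>v \<in> pverts G. nbhd G v \<subseteq> selected first Staller p"
  then show "staller_won G first p"
    unfolding staller_won_def dominating_set_def nbhd_def using arcs_symmetric by blast
qed

lemma nbhd_subset_singleton: "v \<in> pverts G \<Longrightarrow> nbhd G v \<subseteq> {x} \<longleftrightarrow> isolated G v \<and> v = x"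
  unfolding nbhd_def isolated_def using no_loops' by auto

text \<open>Her single move has to fill a closed neighbourhood. The position is kept general so that
  \<open>[]\<close> serves the S-game and \<open>[d]\<close> the D-game.\<close>

lemma forces_one_iff:
  assumes mv: "mover first (length p) = Staller" and S: "selected first Staller p = {}"
  shows "staller_forces G first 1 p \<longleftrightarrow> (\<exists>v. isolated G v \<and> v \<notin> set p)"
proof
  assume "staller_forces G first 1 p"
  then show "\<exists>v. isolated G v \<and> v \<notin> set p"
  proof cases
    case won
    then show ?thesis using S by (auto simp: staller_won_iff nbhd_def)
  next
    case (staller_move x)
    then have "staller_won G first (p @ [x])"
      using staller_forces_exhausted[of G first 1 "p @ [x]"] by (simp add: selected_snoc S)
    then show ?thesis using staller_move(2)
      by (auto simp: staller_won_iff selected_snoc S mv nbhd_subset_singleton)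
  next
    case dominator_move
    then show ?thesis using mv by simp
  qed
next
  assume "\<exists>v. isolated G v \<and> v \<notin> set p"
  then obtain v where v: "isolated G v" "v \<notin> set p" by blast
  then have "v \<in> pverts G" by (simp add: isolated_def)
  moreover from this have "nbhd G v \<subseteq> {v}" using v(1) nbhd_subset_singleton by simp
  ultimately have "staller_forces G first 1 (p @ [v])"
    by (intro won) (auto simp: staller_won_iff selected_snoc S mv)
  then show "staller_forces G first 1 p"
    using mv v(2) \<open>v \<in> pverts G\<close> by - (rule staller_move[where x = v], auto)
qed

text \<open>Without a free isolated vertex, the first move \<open>x\<close> needs two different
  completing vertices, since Dominator can take one of them; each turns out to be a leaf at
  \<open>x\<close>.\<close>

lemma forces_two_iff:
  assumes mv: "mover first (length p) = Staller" and S: "selected first Staller p = {}"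
  shows "staller_forces G first 2 p \<longleftrightarrow> (\<exists>v. isolated G v \<and> v \<notin> set p) \<or>
    (\<exists>x a b. cherry G x a b \<and> x \<notin> set p \<and> a \<notin> set p \<and> b \<notin> set p)"
proof
  assume "staller_forces G first 2 p"
  then show "(\<exists>v. isolated G v \<and> v \<notin> set p) \<or>
    (\<exists>x a b. cherry G x a b \<and> x \<notin> set p \<and> a \<notin> set p \<and> b \<notin> set p)"
  proof cases
    case won
    then show ?thesis using S by (auto simp: staller_won_iff nbhd_def)
  next
    case dominator_move
    then show ?thesis using mv by simp
  next
    case (staller_move x)
    have mv1: "mover first (Suc (length p)) = Dominator"
      using mv by (cases first) (auto simp: mover_def split: if_splits)
    have mv2: "mover first (Suc (Suc (length p))) = Staller"
      using mv by (simp add: mover_def)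
    from staller_move(3) show ?thesis
    proof cases
      case won
      then show ?thesis using staller_move(2)
        by (auto simp: staller_won_iff selected_snoc S mv nbhd_subset_singleton)
    next
      case (staller_move y)
      then show ?thesis using mv1 by simp
    next
      case dominator_move
      \<comment> \<open>Two Staller moves exhaust the bound, so after any reply \<open>y\<close> the
        win comes from \<open>x\<close> alone or from \<open>x\<close> and one further free vertex
        \<open>z\<close>.\<close>
      have reply: "isolated G x \<or>
          (\<exists>z v. z \<in> pverts G - set p - {x, y} \<and> v \<in> pverts G \<and> nbhd G v \<subseteq> {x, z})"
        if y: "y \<in> pverts G - set p - {x}" for y
      proof -
        have "staller_forces G first 2 (p @ [x, y])"
          using dominator_move(3)[of y] y by simp
        then show ?thesis
        proof cases
          case won
          then show ?thesis
            using selected_snoc[of first Staller "p @ [x]" y]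
            by (auto simp: staller_won_iff selected_snoc S mv mv1 nbhd_subset_singleton)
        next
          case (staller_move z)
          have "selected first Staller (p @ [x, y, z]) = {x, z}"
            using selected_snoc[of first Staller "p @ [x]" y]
              selected_snoc[of first Staller "p @ [x, y]" z]
            by (auto simp: selected_snoc S mv mv1 mv2)
          then have "staller_won G first (p @ [x, y, z])"
            using staller_forces_exhausted[of G first 2 "p @ [x, y, z]"] staller_move by auto
          then show ?thesis
            using \<open>selected first Staller (p @ [x, y, z]) = {x, z}\<close> staller_move(2)
            by (auto simp: staller_won_iff)
        next
          case dominator_move
          then show ?thesis using mv2 by simp
        qed
      qed
      show ?thesis
      proof (cases "\<exists>v. isolated G v \<and> v \<notin> set p")
        case False
        \<comment> \<open>As no free vertex is isolated, a closed neighbourhood inside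
          \<open>{x, z}\<close> consists of a leaf and its neighbour.\<close>
        have pendant: "v = x \<and> leaf G x z \<or> v = z \<and> leaf G z x"
          if vz: "v \<in> pverts G" "nbhd G v \<subseteq> {x, z}" "z \<in> pverts G - set p" for v z
        proof -
          have "v = x \<or> v = z" and "\<not> isolated G v"
            using vz False staller_move(2) by (auto simp: nbhd_def)
          then obtain u where "(v, u) \<in> parcs G" "u \<noteq> v"
            using vz(1) no_loops' unfolding isolated_def by metis
          moreover have "(w = x \<or> w = z) \<and> w \<noteq> v" if "(v, w) \<in> parcs G" for w
            using vz(2) no_loops'[OF that] that by (auto simp: nbhd_def)
          ultimately show ?thesis
            using \<open>v = x \<or> v = z\<close> unfolding leaf_def by metis
        qed
        have nx: "\<not> isolated G x" using False staller_move(2) by blast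
        \<comment> \<open>An arbitrary reply produces \<open>a\<close>; the reply \<open>a\<close>
          then produces a different vertex \<open>b\<close>.\<close>
        obtain y where "y \<in> pverts G - set p - {x}" using dominator_move(2) by auto
        from reply[OF this] nx obtain a v where
          a: "a \<in> pverts G - set p - {x}" "v \<in> pverts G" "nbhd G v \<subseteq> {x, a}" by blast
        from reply[OF a(1)] nx obtain b w where
          b: "b \<in> pverts G - set p - {x, a}" "w \<in> pverts G" "nbhd G w \<subseteq> {x, b}" by blast
        \<comment> \<open>In each case \<open>x\<close> is adjacent to both \<open>a\<close> and
          \<open>b\<close>, so \<open>x\<close> itself cannot be the leaf.\<close>
        have "leaf G a x \<and> leaf G b x"
          using pendant[OF a(2,3)] pendant[OF b(2,3)] a(1) b(1) arcs_symmetric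
          unfolding leaf_def by blast
        then show ?thesis using a(1) b(1) staller_move(2) unfolding cherry_def by blast
      qed simp
    qed
  qed
next
  assume "(\<exists>v. isolated G v \<and> v \<notin> set p) \<or>
    (\<exists>x a b. cherry G x a b \<and> x \<notin> set p \<and> a \<notin> set p \<and> b \<notin> set p)"
  then show "staller_forces G first 2 p"
  proof (elim disjE exE conjE)
    fix v assume v: "isolated G v" "v \<notin> set p"
    then have "v \<in> pverts G" by (simp add: isolated_def)
    moreover from this have "nbhd G v \<subseteq> {v}" using v(1) nbhd_subset_singleton by simp
    ultimately have "staller_forces G first 2 (p @ [v])"
      by (intro won) (auto simp: staller_won_iff selected_snoc S mv)
    then show ?thesis
      using mv v(2) \<open>v \<in> pverts G\<close> by - (rule staller_move[where x = v], auto)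
  next
    fix x a b assume ch: "cherry G x a b" and new: "x \<notin> set p" "a \<notin> set p" "b \<notin> set p"
    have mv1: "mover first (Suc (length p)) = Dominator"
      using mv by (cases first) (auto simp: mover_def split: if_splits)
    have mv2: "mover first (Suc (Suc (length p))) = Staller"
      using mv by (simp add: mover_def)
    have V: "x \<in> pverts G" "a \<in> pverts G" "b \<in> pverts G" and ne: "a \<noteq> x" "b \<noteq> x" "a \<noteq> b"
      using ch no_loops' wellformed' unfolding cherry_def leaf_def by blast+
    have "staller_forces G first 2 (p @ [x, y])" if y: "y \<in> pverts G - set (p @ [x])" for y
    proof -
      \<comment> \<open>Dominator's reply blocks at most one of the two leaves.\<close>
      obtain z where z: "z = a \<or> z = b" "z \<noteq> y" using ne by blast
      then have "nbhd G z \<subseteq> {x, z}"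
        using ch unfolding cherry_def leaf_def nbhd_def by blast
      moreover have sel: "selected first Staller (p @ [x, y, z]) = {x, z}"
        using selected_snoc[of first Staller "p @ [x]" y]
          selected_snoc[of first Staller "p @ [x, y]" z]
        by (auto simp: selected_snoc S mv mv1 mv2)
      moreover have "z \<in> pverts G" using z V by blast
      ultimately have "staller_forces G first 2 (p @ [x, y, z])"
        by (intro won) (auto simp: staller_won_iff card_insert_if)
      moreover have "z \<in> pverts G - set (p @ [x, y])" using z V ne new by auto
      ultimately show ?thesis using mv2 by - (rule staller_move[where x = z], auto)
    qed
    then have "staller_forces G first 2 (p @ [x])"
      using mv1 V ne new by - (rule dominator_move, auto)
    then show ?thesis using mv new V by - (rule staller_move[where x = x], auto)
  qed
qed

text \<open>A graph without vertices has no closed neighbourhood to fill, so Staller cannot win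
  there; hence the nonemptiness conjunct.\<close>

lemma dominator_first_forces_iff:
  "staller_forces G Dominator k [] \<longleftrightarrow>
    pverts G \<noteq> {} \<and> (\<forall>d \<in> pverts G. staller_forces G Dominator k [d])"
proof
  assume "staller_forces G Dominator k []"
  then show "pverts G \<noteq> {} \<and> (\<forall>d \<in> pverts G. staller_forces G Dominator k [d])"
    by cases (auto simp: staller_won_iff nbhd_def mover_def)
next
  assume "pverts G \<noteq> {} \<and> (\<forall>d \<in> pverts G. staller_forces G Dominator k [d])"
  then show "staller_forces G Dominator k []"
    by - (rule dominator_move, auto simp: mover_def)
qed

lemma staller_wins_S_one_iff: "staller_wins_within G Staller 1 \<longleftrightarrow> (\<exists>v. isolated G v)"
  using forces_one_iff[of Staller "[]"] pair_finite_verts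
  by (simp add: staller_wins_within_iff_forces mover_def)

lemma staller_wins_S_two_iff:
  "staller_wins_within G Staller 2 \<longleftrightarrow> (\<exists>v. isolated G v) \<or> (\<exists>x a b. cherry G x a b)"
  using forces_two_iff[of Staller "[]"] pair_finite_verts
  by (simp add: staller_wins_within_iff_forces mover_def)

lemma staller_wins_D_one_iff:
  "staller_wins_within G Dominator 1 \<longleftrightarrow> (\<exists>v w. isolated G v \<and> isolated G w \<and> v \<noteq> w)"
proof -
  have "selected Dominator Staller [d] = {}" for d :: 'a
    using selected_snoc[of Dominator Staller "[]" d] by (simp add: mover_def)
  then have "staller_forces G Dominator 1 [d] \<longleftrightarrow> (\<exists>v. isolated G v \<and> v \<noteq> d)" for d
    using forces_one_iff[of Dominator "[d]"] by (simp add: mover_def)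
  then have "staller_wins_within G Dominator 1 \<longleftrightarrow>
      pverts G \<noteq> {} \<and> (\<forall>d \<in> pverts G. \<exists>v. isolated G v \<and> v \<noteq> d)"
    using pair_finite_verts by (simp add: staller_wins_within_iff_forces dominator_first_forces_iff)
  then show ?thesis unfolding isolated_def by (metis ex_in_conv)
qed

lemma staller_wins_D_two_iff:
  "staller_wins_within G Dominator 2 \<longleftrightarrow> pverts G \<noteq> {} \<and>
    (\<forall>d \<in> pverts G. (\<exists>v. isolated G v \<and> v \<noteq> d) \<or>
      (\<exists>x a b. cherry G x a b \<and> x \<noteq> d \<and> a \<noteq> d \<and> b \<noteq> d))"
proof -
  have "selected Dominator Staller [d] = {}" for d :: 'a
    using selected_snoc[of Dominator Staller "[]" d] by (simp add: mover_def)
  then have "staller_forces G Dominator 2 [d] \<longleftrightarrow> (\<exists>v. isolated G v \<and> v \<noteq> d) \<or>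
      (\<exists>x a b. cherry G x a b \<and> x \<noteq> d \<and> a \<noteq> d \<and> b \<noteq> d)" for d
    using forces_two_iff[of Dominator "[d]"] by (simp add: mover_def)
  then show ?thesis
    using pair_finite_verts by (simp add: staller_wins_within_iff_forces dominator_first_forces_iff)
qed

end

section \<open>From the game numbers to winning within a bound\<close>

lemma staller_wins_within_mono:
  "staller_wins_within G first k \<Longrightarrow> k \<le> l \<Longrightarrow> staller_wins_within G first l"
  unfolding staller_wins_within_def using le_trans by meson

text \<open>An empty set has infimum \<open>\<infinity>\<close>, and the infimum of a nonempty one
  is attained; monotonicity carries the win from the attained value to \<open>k\<close>.\<close>

lemma staller_number_le_iff: "staller_number first G \<le> enat k \<longleftrightarrow> staller_wins_within G first k"
proof
  assume le: "staller_number first G \<le> enat k"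
  let ?A = "{enat l | l. staller_wins_within G first l}"
  have ne: "?A \<noteq> {}"
    using le unfolding staller_number_def by (metis Inf_enat_def infinity_ileE)
  then have "Inf ?A \<in> ?A"
    unfolding Inf_enat_def by (metis (mono_tags, lifting) LeastI_ex ex_in_conv)
  then obtain l where "staller_number first G = enat l" "staller_wins_within G first l"
    unfolding staller_number_def by blast
  then show "staller_wins_within G first k"
    using le staller_wins_within_mono by simp
next
  assume "staller_wins_within G first k"
  then show "staller_number first G \<le> enat k"
    unfolding staller_number_def by (intro Inf_lower) blast
qed

text \<open>The value two means a win within two moves and none within one. Given this, a larger
  value after adding an edge means that two moves no longer suffice.\<close>

lemma critical_two_iff:
  "critical (staller_number first) 2 G \<longleftrightarrow>
    staller_wins_within G first 2 \<and> \<not> staller_wins_within G first 1 \<and>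
    (\<forall>u \<in> pverts G. \<forall>v \<in> pverts G. u \<noteq> v \<and> (u, v) \<notin> parcs G \<longrightarrow>
      \<not> staller_wins_within (add_edge G u v) first 2)"
proof -
  have eq: "staller_number first G = enat 2 \<longleftrightarrow>
      staller_number first G \<le> enat 2 \<and> \<not> staller_number first G \<le> enat 1"
    by (cases "staller_number first G") auto
  then show ?thesis
    unfolding critical_def staller_number_le_iff[symmetric] by (auto simp: not_le)
qed

section \<open>Adding an edge\<close>

context pair_graph
begin

lemma pair_graph_add_edge:
  assumes "u \<in> pverts G" "v \<in> pverts G" "u \<noteq> v"
  shows "pair_graph (add_edge G u v)"
proof
  show "symmetric (with_proj (add_edge G u v))"
    by (auto simp: symmetric_def sym_def add_edge_def intro: arcs_symmetric)
qed (insert assms pair_finite_verts pair_finite_arcs,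
  auto simp: add_edge_def dest: in_arcsD1 in_arcsD2 no_loops')

lemma isolated_add_edge:
  "isolated (add_edge G u v) w \<longleftrightarrow> isolated G w \<and> w \<noteq> u \<and> w \<noteq> v"
  unfolding isolated_def add_edge_def by auto

text \<open>An old leaf on the new edge gains a second neighbour, and a new leaf can only come from
  an isolated endpoint.\<close>

lemma leaf_add_edge:
  assumes "u \<in> pverts G" "v \<in> pverts G" "u \<noteq> v" "(u, v) \<notin> parcs G"
  shows "leaf (add_edge G u v) l s \<longleftrightarrow> leaf G l s \<and> l \<noteq> u \<and> l \<noteq> v \<or>
    isolated G l \<and> (l = u \<and> s = v \<or> l = v \<and> s = u)"
proof -
  have "(v, u) \<notin> parcs G" using assms(4) arcs_symmetric by blast
  then show ?thesis using assms unfolding leaf_def isolated_def add_edge_def by auto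
qed

text \<open>Only the neighbourhoods of the two leaves matter, so the new edge may end at the
  centre.\<close>

lemma cherry_add_edge:
  assumes "cherry G x a b" "u \<in> pverts G - {a, b}" "v \<in> pverts G - {a, b}" "u \<noteq> v"
    "(u, v) \<notin> parcs G"
  shows "cherry (add_edge G u v) x a b"
  using assms leaf_add_edge[of u v] unfolding cherry_def by blast

lemma cherryD:
  assumes "cherry G x a b"
  shows "x \<in> pverts G" "a \<in> pverts G" "b \<in> pverts G" "a \<noteq> b" "x \<noteq> a" "x \<noteq> b"
    "(a, u) \<in> parcs G \<longleftrightarrow> u = x" "(b, u) \<in> parcs G \<longleftrightarrow> u = x"
  using assms wellformed' no_loops' unfolding cherry_def leaf_def by blast+

text \<open>A centre has two neighbours and so is no leaf, and a leaf determines its centre.\<close>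

lemma cherries_disjoint:
  assumes "cherry G x a b" "cherry G y c d" "x \<noteq> y"
  shows "distinct [x, y, a, b, c, d]"
proof -
  note ab = cherryD[OF assms(1)] and cd = cherryD[OF assms(2)]
  have "(x, a) \<in> parcs G" "(x, b) \<in> parcs G" "(y, c) \<in> parcs G" "(y, d) \<in> parcs G"
    using ab(7,8) cd(7,8) arcs_symmetric by blast+
  then have "x \<noteq> c" "x \<noteq> d" "y \<noteq> a" "y \<noteq> b"
    using ab(4,7,8) cd(4,7,8) by metis+
  moreover have "a \<noteq> c" "a \<noteq> d" "b \<noteq> c" "b \<noteq> d"
    using ab(7,8) cd(7,8) assms(3) by metis+
  ultimately show ?thesis using ab(4-6) cd(4-6) assms(3) by simp
qed

end

section \<open>Cliques with pendant vertices\<close>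

text \<open>The vertices outside \<open>L\<close> form a clique; the pairs in \<open>R\<close> join vertices of \<open>L\<close> to it.
  Members of \<open>L\<close> that do not occur in \<open>R\<close> are isolated.\<close>

definition clique_with_pendants :: "'a pair_pre_digraph \<Rightarrow> 'a set \<Rightarrow> 'a rel \<Rightarrow> bool" where
  "clique_with_pendants G L R \<longleftrightarrow> (\<forall>u \<in> pverts G. \<forall>v \<in> pverts G. (u, v) \<in> parcs G \<longleftrightarrow>
     u \<noteq> v \<and> (u \<notin> L \<and> v \<notin> L \<or> (u, v) \<in> R \<or> (v, u) \<in> R))"

text \<open>The definition is symmetric in both ends, which suits transport along bijections; this
  form fixes the neighbours of each member of \<open>L\<close>, which suits leaves and isolated
  vertices.\<close>

lemma (in pair_graph) clique_with_pendants_iff: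
  assumes "L \<subseteq> pverts G" "R \<subseteq> L \<times> (pverts G - L)"
  shows "clique_with_pendants G L R \<longleftrightarrow>
    (\<forall>u \<in> pverts G - L. \<forall>v \<in> pverts G - L. u \<noteq> v \<longrightarrow> (u, v) \<in> parcs G) \<and>
    (\<forall>l \<in> L. \<forall>u. (l, u) \<in> parcs G \<longleftrightarrow> (l, u) \<in> R)" (is "?lhs \<longleftrightarrow> ?rhs")
proof
  assume ?lhs
  then have E: "(u, v) \<in> parcs G \<longleftrightarrow>
      u \<noteq> v \<and> (u \<notin> L \<and> v \<notin> L \<or> (u, v) \<in> R \<or> (v, u) \<in> R)"
    if "u \<in> pverts G" "v \<in> pverts G" for u v
    using that unfolding clique_with_pendants_def by blast
  show ?rhs
  proof (intro conjI ballI allI impI)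
    fix u v assume "u \<in> pverts G - L" "v \<in> pverts G - L" "u \<noteq> v"
    then show "(u, v) \<in> parcs G" using E[of u v] by blast
  next
    fix l u assume "l \<in> L"
    then show "(l, u) \<in> parcs G \<longleftrightarrow> (l, u) \<in> R"
      using E[of l u] assms wellformed'[of l u] by blast
  qed
next
  assume rhs: ?rhs
  show ?lhs unfolding clique_with_pendants_def
  proof (intro ballI)
    fix u v assume "u \<in> pverts G" "v \<in> pverts G"
    then show "(u, v) \<in> parcs G \<longleftrightarrow>
        u \<noteq> v \<and> (u \<notin> L \<and> v \<notin> L \<or> (u, v) \<in> R \<or> (v, u) \<in> R)"
      using rhs assms(2) no_loops'[of u v] arcs_symmetric[of u v] arcs_symmetric[of v u] by blast
  qed
qed

text \<open>\<open>W\<close> collects the isolated vertices: \<open>{}\<close> gives G_n' and a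
  singleton gives G_n' with K_1, so the same lemmas serve both games.\<close>

definition one_center_clique :: "'a pair_pre_digraph \<Rightarrow> 'a set \<Rightarrow> 'a \<Rightarrow> 'a \<Rightarrow> 'a \<Rightarrow> bool" where
  "one_center_clique G W x a b \<longleftrightarrow>
     distinct [x, a, b] \<and> {x, a, b} \<inter> W = {} \<and> {x, a, b} \<union> W \<subseteq> pverts G \<and>
     clique_with_pendants G ({a, b} \<union> W) {(a, x), (b, x)}"

definition two_center_clique ::
    "'a pair_pre_digraph \<Rightarrow> 'a \<Rightarrow> 'a \<Rightarrow> 'a \<Rightarrow> 'a \<Rightarrow> 'a \<Rightarrow> 'a \<Rightarrow> bool" where
  "two_center_clique G x y a b c d \<longleftrightarrow>
     distinct [x, y, a, b, c, d] \<and> {x, y, a, b, c, d} \<subseteq> pverts G \<and>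
     clique_with_pendants G {a, b, c, d} {(a, x), (b, x), (c, y), (d, y)}"

context pair_graph
begin

lemma one_center_clique_iff:
  "one_center_clique G W x a b \<longleftrightarrow>
     distinct [x, a, b] \<and> {x, a, b} \<inter> W = {} \<and> cherry G x a b \<and> (\<forall>w \<in> W. isolated G w) \<and>
     (\<forall>u \<in> pverts G - ({a, b} \<union> W). \<forall>v \<in> pverts G - ({a, b} \<union> W).
        u \<noteq> v \<longrightarrow> (u, v) \<in> parcs G)" (is "_ \<longleftrightarrow> ?rhs")
proof (cases "distinct [x, a, b] \<and> {x, a, b} \<inter> W = {} \<and> {x, a, b} \<union> W \<subseteq> pverts G")
  case True
  then have "a \<noteq> b" and W: "\<And>w u. w \<in> W \<Longrightarrow> (w, u) \<notin> {(a, x), (b, x)}" and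
    sub: "{a, b} \<union> W \<subseteq> pverts G" "{(a, x), (b, x)} \<subseteq> ({a, b} \<union> W) \<times> (pverts G - ({a, b} \<union> W))"
    by auto
  have "(\<forall>w \<in> W. \<forall>u. (w, u) \<in> parcs G \<longleftrightarrow> (w, u) \<in> {(a, x), (b, x)}) \<longleftrightarrow>
      (\<forall>w \<in> W. isolated G w)"
    using W sub(1) unfolding isolated_def by blast
  moreover have "(\<forall>w \<in> {a, b}. \<forall>u. (w, u) \<in> parcs G \<longleftrightarrow> (w, u) \<in> {(a, x), (b, x)}) \<longleftrightarrow>
      cherry G x a b"
    using \<open>a \<noteq> b\<close> unfolding cherry_def leaf_iff by simp
  ultimately have "(\<forall>l \<in> {a, b} \<union> W. \<forall>u. (l, u) \<in> parcs G \<longleftrightarrow> (l, u) \<in> {(a, x), (b, x)}) \<longleftrightarrow>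
      cherry G x a b \<and> (\<forall>w \<in> W. isolated G w)"
    unfolding ball_Un by argo
  then show ?thesis
    using True unfolding one_center_clique_def clique_with_pendants_iff[OF sub] by argo
next
  case False
  then show ?thesis
    using cherryD(1-3)[of x a b] unfolding one_center_clique_def isolated_def by auto
qed

lemma two_center_clique_iff:
  "two_center_clique G x y a b c d \<longleftrightarrow>
     cherry G x a b \<and> cherry G y c d \<and> x \<noteq> y \<and>
     (\<forall>u \<in> pverts G - {a, b, c, d}. \<forall>v \<in> pverts G - {a, b, c, d}.
        u \<noteq> v \<longrightarrow> (u, v) \<in> parcs G)" (is "_ \<longleftrightarrow> ?rhs")
proof (cases "distinct [x, y, a, b, c, d] \<and> {x, y, a, b, c, d} \<subseteq> pverts G")
  case True
  let ?L = "{a, b, c, d}" and ?R = "{(a, x), (b, x), (c, y), (d, y)}"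
  have sub: "?L \<subseteq> pverts G" "?R \<subseteq> ?L \<times> (pverts G - ?L)"
    and dist': "distinct [d, c, b, a]" using True by auto
  have "(\<forall>l \<in> ?L. \<forall>u. (l, u) \<in> parcs G \<longleftrightarrow> (l, u) \<in> ?R) \<longleftrightarrow> cherry G x a b \<and> cherry G y c d"
    using True dist' unfolding cherry_def leaf_iff by simp
  moreover have "x \<noteq> y" using True by simp
  ultimately show ?thesis
    using True unfolding two_center_clique_def clique_with_pendants_iff[OF sub] by argo
next
  case False
  \<comment> \<open>Two cherries with different centres already force all six vertices to be
    distinct, by \<open>cherries_disjoint\<close>.\<close>
  have "\<not> (cherry G x a b \<and> cherry G y c d \<and> x \<noteq> y)"
  proof
    assume ch: "cherry G x a b \<and> cherry G y c d \<and> x \<noteq> y"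
    then have "distinct [x, y, a, b, c, d]" using cherries_disjoint by blast
    moreover have "{x, y, a, b, c, d} \<subseteq> pverts G"
      using ch cherryD(1-3)[of x a b] cherryD(1-3)[of y c d] by simp
    ultimately show False using False by blast
  qed
  then show ?thesis using False unfolding two_center_clique_def by argo
qed

section \<open>Isolated vertices, leaves and new edges in one-centre cliques\<close>

lemma one_center_clique_center:
  assumes "one_center_clique G W x a b" "v \<in> pverts G - W" "v \<noteq> x"
  shows "(v, x) \<in> parcs G" "(x, v) \<in> parcs G"
proof -
  show "(v, x) \<in> parcs G"
    using assms cherryD[of x a b] unfolding one_center_clique_iff by blast
  then show "(x, v) \<in> parcs G" by (rule arcs_symmetric)
qed

lemma one_center_clique_isolated:
  assumes G: "one_center_clique G W x a b"
  shows "isolated G v \<longleftrightarrow> v \<in> W"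
proof
  assume v: "isolated G v"
  show "v \<in> W"
  proof (rule ccontr)
    assume "v \<notin> W"
    then show False
      using v one_center_clique_center[OF G, of v] one_center_clique_center[OF G, of a]
        G cherryD[of x a b] unfolding one_center_clique_iff isolated_def by auto
  qed
qed (use G in \<open>auto simp: one_center_clique_iff\<close>)

text \<open>\<open>x\<close> has the neighbours \<open>a\<close> and \<open>b\<close>, and every
  other vertex outside \<open>W\<close> is adjacent to \<open>x\<close>. Leaves besides
  \<open>a\<close> and \<open>b\<close> are possible: in a clique of two vertices the one other than
  \<open>x\<close> is a leaf too.\<close>

lemma one_center_clique_leaf:
  assumes G: "one_center_clique G W x a b" and l: "leaf G l s"
  shows "s = x" "l \<noteq> x" "l \<in> pverts G - W"
proof -
  have lv: "l \<in> pverts G" using l wellformed' unfolding leaf_def by blast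
  have "l \<notin> W" using l G unfolding leaf_def one_center_clique_iff isolated_def by blast
  then show lW: "l \<in> pverts G - W" using lv by blast
  have ab: "a \<in> pverts G - W" "b \<in> pverts G - W" "a \<noteq> x" "b \<noteq> x" "a \<noteq> b"
    using G unfolding one_center_clique_def by auto
  show "l \<noteq> x"
    using one_center_clique_center(2)[OF G ab(1,3)] one_center_clique_center(2)[OF G ab(2,4)]
      ab(5) l unfolding leaf_def by blast
  then show "s = x"
    using one_center_clique_center(1)[OF G lW] l unfolding leaf_def by blast
qed

text \<open>Neither endpoint was isolated, so the leaves of a cherry in the new graph would be two
  old leaves at \<open>x\<close> that avoid \<open>u\<close> and \<open>v\<close>.\<close>

lemma one_center_clique_add_edge:
  assumes G: "one_center_clique G W x a b"
    and uv: "u \<in> pverts G - W" "v \<in> pverts G - W" "u \<noteq> v" "(u, v) \<notin> parcs G"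
  shows "\<not> cherry (add_edge G u v) y c d"
proof
  assume "cherry (add_edge G u v) y c d"
  then have "leaf G c y" "leaf G d y" and new: "c \<noteq> d" "c \<notin> {u, v}" "d \<notin> {u, v}"
    using leaf_add_edge[of u v] uv one_center_clique_isolated[OF G]
    unfolding cherry_def by blast+
  then have lf: "leaf G c x" "leaf G d x" and cd: "c \<noteq> x" "d \<noteq> x" "c \<in> pverts G - W" "d \<in> pverts G - W"
    using one_center_clique_leaf[OF G] by blast+
  have uvx: "u \<noteq> x" "v \<noteq> x"
    using uv one_center_clique_center[OF G] by blast+
  have clique: "u' \<in> pverts G - W \<Longrightarrow> v' \<in> pverts G - W \<Longrightarrow> u' \<notin> {a, b} \<Longrightarrow> v' \<notin> {a, b} \<Longrightarrow>
      u' \<noteq> v' \<Longrightarrow> (u', v') \<in> parcs G" for u' v'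
    using G unfolding one_center_clique_iff by blast
  \<comment> \<open>If \<open>l\<close> were in the clique, a clique vertex \<open>w\<close> besides
    \<open>x\<close> would be its second neighbour.\<close>
  have outside: "l \<in> {a, b}" if "leaf G l x" "l \<noteq> x" "l \<in> pverts G - W"
    "w \<in> pverts G - W" "w \<notin> {a, b}" "w \<noteq> l" "w \<noteq> x" for l w
    using clique[of l w] that unfolding leaf_def by blast
  \<comment> \<open>If the edge joins \<open>a\<close> and \<open>b\<close>, then \<open>c\<close>
    and \<open>d\<close> are clique vertices, adjacent to each other. Otherwise an endpoint in the
    clique forces \<open>c\<close> and \<open>d\<close> to be \<open>a\<close> and \<open>b\<close>,
    one of which lies on the new edge since \<open>u\<close> and \<open>v\<close> were not
    adjacent.\<close>
  show False
  proof (cases "u \<in> {a, b} \<and> v \<in> {a, b}")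
    case True
    then have "c \<notin> {a, b}" "d \<notin> {a, b}" using new uv(3) by auto
    then show False using outside[OF lf(1), of d] cd new(1) by blast
  next
    case False
    then have "c \<in> {a, b}" "d \<in> {a, b}"
      using outside[OF lf(1), of u] outside[OF lf(1), of v] outside[OF lf(2), of u]
        outside[OF lf(2), of v] uv uvx cd new by blast+
    moreover have "u \<in> {a, b} \<or> v \<in> {a, b}" using clique[of u v] uv by blast
    ultimately show False using new by blast
  qed
qed

section \<open>Criticality in the S-game and the D-game\<close>

lemma critical_S_iff:
  "critical gamma_SMB' 2 G \<longleftrightarrow> (\<exists>x a b. one_center_clique G {} x a b)"
proof
  assume "critical gamma_SMB' 2 G"
  then have wins: "staller_wins_within G Staller 2" and noiso: "\<not> isolated G v"
    and crit: "\<And>u v. u \<in> pverts G \<Longrightarrow> v \<in> pverts G \<Longrightarrow> u \<noteq> v \<Longrightarrow> (u, v) \<notin> parcs G \<Longrightarrow>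
      \<not> staller_wins_within (add_edge G u v) Staller 2" for v
    unfolding gamma_SMB'_def critical_two_iff staller_wins_S_one_iff by blast+
  then obtain x a b where ch: "cherry G x a b" unfolding staller_wins_S_two_iff by blast
  \<comment> \<open>Adding a missing edge here would preserve the cherry and with it the win,
    against criticality.\<close>
  have "(u, v) \<in> parcs G" if uv: "u \<in> pverts G - {a, b}" "v \<in> pverts G - {a, b}" "u \<noteq> v" for u v
  proof (rule ccontr)
    assume "(u, v) \<notin> parcs G"
    then show False
      using crit[of u v] uv cherry_add_edge[OF ch uv]
        pair_graph.staller_wins_S_two_iff[OF pair_graph_add_edge[of u v]] by blast
  qed
  then have "one_center_clique G {} x a b"
    using ch cherryD[OF ch] unfolding one_center_clique_iff by auto
  then show "\<exists>x a b. one_center_clique G {} x a b" by blast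
next
  assume "\<exists>x a b. one_center_clique G {} x a b"
  then obtain x a b where G: "one_center_clique G {} x a b" by blast
  have noiso: "\<not> isolated G v" for v using one_center_clique_isolated[OF G] by simp
  have "\<not> staller_wins_within (add_edge G u v) Staller 2"
    if "u \<in> pverts G" "v \<in> pverts G" "u \<noteq> v" "(u, v) \<notin> parcs G" for u v
    using that one_center_clique_add_edge[OF G, of u v] noiso isolated_add_edge
      pair_graph.staller_wins_S_two_iff[OF pair_graph_add_edge[of u v]] by blast
  then show "critical gamma_SMB' 2 G"
    using G noiso unfolding gamma_SMB'_def critical_two_iff staller_wins_S_one_iff
      staller_wins_S_two_iff one_center_clique_iff by blast
qed

text \<open>The structure is read off from well-chosen openings of Dominator: the isolated vertex if
  there is one, and otherwise the centre of a first cherry. Staller's answer supplies the other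
  chance.\<close>

lemma critical_D_imp:
  assumes "critical gamma_SMB 2 G"
  shows "(\<exists>w x a b. one_center_clique G {w} x a b) \<or> (\<exists>x y a b c d. two_center_clique G x y a b c d)"
proof -
  have ne: "pverts G \<noteq> {}"
    and wins: "\<And>d. d \<in> pverts G \<Longrightarrow> (\<exists>v. isolated G v \<and> v \<noteq> d) \<or>
      (\<exists>x a b. cherry G x a b \<and> x \<noteq> d \<and> a \<noteq> d \<and> b \<noteq> d)"
    and iso: "\<And>v w. isolated G v \<Longrightarrow> isolated G w \<Longrightarrow> v = w"
    and crit: "\<And>u v. u \<in> pverts G \<Longrightarrow> v \<in> pverts G \<Longrightarrow> u \<noteq> v \<Longrightarrow> (u, v) \<notin> parcs G \<Longrightarrow>
      \<not> staller_wins_within (add_edge G u v) Dominator 2"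
    using assms unfolding gamma_SMB_def critical_two_iff staller_wins_D_one_iff
      staller_wins_D_two_iff by blast+
  \<comment> \<open>Criticality in contrapositive form: an edge is present if adding it would leave
    Staller an answer to every opening \<open>d\<close>.\<close>
  have crit': "(u, v) \<in> parcs G"
    if uv: "u \<in> pverts G" "v \<in> pverts G" "u \<noteq> v"
      and win: "(u, v) \<notin> parcs G \<Longrightarrow> \<forall>d \<in> pverts G. (\<exists>v'. isolated (add_edge G u v) v' \<and> v' \<noteq> d) \<or>
        (\<exists>x a b. cherry (add_edge G u v) x a b \<and> x \<noteq> d \<and> a \<noteq> d \<and> b \<noteq> d)" for u v
  proof (rule ccontr)
    assume "(u, v) \<notin> parcs G"
    moreover have "pverts (add_edge G u v) = pverts G" by (simp add: add_edge_def)
    ultimately show False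
      using crit[of u v] uv win ne
        pair_graph.staller_wins_D_two_iff[OF pair_graph_add_edge[OF uv]] by simp
  qed
  show ?thesis
  proof (cases "\<exists>w. isolated G w")
    case True
    then obtain w where w: "isolated G w" by blast
    then obtain x a b where ch: "cherry G x a b" and new: "x \<noteq> w" "a \<noteq> w" "b \<noteq> w"
      using wins[of w] iso[OF w] unfolding isolated_def by blast
    have "(u, v) \<in> parcs G"
      if uv: "u \<in> pverts G - ({a, b} \<union> {w})" "v \<in> pverts G - ({a, b} \<union> {w})" "u \<noteq> v" for u v
    proof (rule crit')
      assume "(u, v) \<notin> parcs G"
      then have "cherry (add_edge G u v) x a b" "isolated (add_edge G u v) w"
        using cherry_add_edge[OF ch, of u v] uv w isolated_add_edge by blast+
      \<comment> \<open>Both chances survive the new edge, and no single opening can hit both of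
        them.\<close>
      then show "\<forall>d \<in> pverts G. (\<exists>v'. isolated (add_edge G u v) v' \<and> v' \<noteq> d) \<or>
        (\<exists>x a b. cherry (add_edge G u v) x a b \<and> x \<noteq> d \<and> a \<noteq> d \<and> b \<noteq> d)"
        using new by blast
    qed (use uv in auto)
    then have "one_center_clique G {w} x a b"
      using ch cherryD[OF ch] new w unfolding one_center_clique_iff by auto
    then show ?thesis by blast
  next
    case False
    then obtain x a b where ch: "cherry G x a b" using ne wins by blast
    then obtain y c d where ch2: "cherry G y c d" and "x \<noteq> y"
      using wins[of x] cherryD(1)[OF ch] False by blast
    then have dist: "distinct [x, y, a, b, c, d]" using cherries_disjoint[OF ch] by blast
    have "(u, v) \<in> parcs G"
      if uv: "u \<in> pverts G - {a, b, c, d}" "v \<in> pverts G - {a, b, c, d}" "u \<noteq> v" for u v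
    proof (rule crit')
      assume "(u, v) \<notin> parcs G"
      then have "cherry (add_edge G u v) x a b" "cherry (add_edge G u v) y c d"
        using cherry_add_edge[OF ch, of u v] cherry_add_edge[OF ch2, of u v] uv by blast+
      then show "\<forall>e \<in> pverts G. (\<exists>v'. isolated (add_edge G u v) v' \<and> v' \<noteq> e) \<or>
        (\<exists>x a b. cherry (add_edge G u v) x a b \<and> x \<noteq> e \<and> a \<noteq> e \<and> b \<noteq> e)"
        using dist by (auto; metis)
    qed (use uv in auto)
    then have "two_center_clique G x y a b c d"
      using ch ch2 \<open>x \<noteq> y\<close> unfolding two_center_clique_iff by blast
    then show ?thesis by blast
  qed
qed

text \<open>The new edge spoils one of the two chances and Dominator's opening the other: he takes
  \<open>x\<close> if the edge meets \<open>w\<close>, and \<open>w\<close> otherwise.\<close>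

lemma one_center_clique_critical_D:
  assumes G: "one_center_clique G {w} x a b"
  shows "critical gamma_SMB 2 G"
proof -
  have iso: "isolated G v \<longleftrightarrow> v = w" for v using one_center_clique_isolated[OF G] by simp
  have w: "w \<in> pverts G" using iso unfolding isolated_def by blast
  have x: "x \<in> pverts G" "x \<noteq> w" "cherry G x a b" "a \<noteq> w" "b \<noteq> w"
    using G cherryD[of x a b] unfolding one_center_clique_iff by auto
  have "\<not> staller_wins_within (add_edge G u v) Dominator 2"
    if uv: "u \<in> pverts G" "v \<in> pverts G" "u \<noteq> v" and nadj: "(u, v) \<notin> parcs G" for u v
  proof -
    interpret H: pair_graph "add_edge G u v" by (rule pair_graph_add_edge[OF uv])
    have V: "pverts (add_edge G u v) = pverts G" by (simp add: add_edge_def)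
    show ?thesis
    proof (cases "u = w \<or> v = w")
      case True
      \<comment> \<open>A leaf with another centre must have been isolated, hence is
        \<open>w\<close>, but a cherry needs two leaves.\<close>
      have "y = x" if ch: "cherry (add_edge G u v) y c d" for y c d
      proof (rule ccontr)
        assume "y \<noteq> x"
        then have "c = w" "d = w"
          using ch leaf_add_edge[OF uv nadj] one_center_clique_leaf(1)[OF G] iso
          unfolding cherry_def by blast+
        then show False using ch unfolding cherry_def by blast
      qed
      moreover have "\<not> isolated (add_edge G u v) z" for z
        using True iso isolated_add_edge by blast
      ultimately show ?thesis unfolding H.staller_wins_D_two_iff V using x(1) by blast
    next
      case False
      then have "\<not> cherry (add_edge G u v) y c d" for y c d
        using one_center_clique_add_edge[OF G _ _ uv(3) nadj] uv by blast
      moreover have "isolated (add_edge G u v) z \<longrightarrow> z = w" for z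
        using iso isolated_add_edge by blast
      ultimately show ?thesis unfolding H.staller_wins_D_two_iff V using w by blast
    qed
  qed
  moreover have "staller_wins_within G Dominator 2"
    unfolding staller_wins_D_two_iff iso using w x by blast
  moreover have "\<not> staller_wins_within G Dominator 1"
    unfolding staller_wins_D_one_iff iso by blast
  ultimately show ?thesis unfolding gamma_SMB_def critical_two_iff by blast
qed

section \<open>Two-centre cliques in the D-game\<close>

lemma two_center_clique_swap:
  "two_center_clique G x y a b c d \<Longrightarrow> two_center_clique G y x c d a b"
  unfolding two_center_clique_iff by (auto simp: insert_commute)

lemma two_center_clique_not_isolated:
  assumes "two_center_clique G x y a b c d"
  shows "\<not> isolated G v"
proof
  assume v: "isolated G v"
  have ch: "cherry G x a b" "cherry G y c d" using assms unfolding two_center_clique_iff by blast+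
  have "distinct [x, y, a, b, c, d]" using assms unfolding two_center_clique_def by blast
  then have "v \<notin> {a, b, c, d, x}"
    using v cherryD[OF ch(1)] cherryD[OF ch(2)] arcs_symmetric unfolding isolated_def by blast
  then show False
    using v assms cherryD(1)[OF ch(1)] \<open>distinct _\<close> unfolding two_center_clique_iff isolated_def by auto
qed

text \<open>Each centre has two pendant neighbours, and any further clique vertex is adjacent to
  both centres. Unlike with one centre, no clique vertex is ever a leaf.\<close>

lemma two_center_clique_leaf:
  assumes G: "two_center_clique G x y a b c d" and l: "leaf G l s"
  shows "s = x \<and> l \<in> {a, b} \<or> s = y \<and> l \<in> {c, d}"
proof -
  have ch: "cherry G x a b" "cherry G y c d" using G unfolding two_center_clique_iff by blast+
  have dist: "distinct [x, y, a, b, c, d]" using G unfolding two_center_clique_def by blast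
  have "l \<in> {a, b, c, d}"
  proof (rule ccontr)
    assume nl: "l \<notin> {a, b, c, d}"
    have "\<not> leaf G x s" "\<not> leaf G y s"
      using cherryD(4,7,8)[OF ch(1)] cherryD(4,7,8)[OF ch(2)] arcs_symmetric
      unfolding leaf_def by metis+
    then have "l \<noteq> x" "l \<noteq> y" using l by auto
    moreover have "l \<in> pverts G" using l wellformed' unfolding leaf_def by blast
    ultimately have "(l, x) \<in> parcs G" "(l, y) \<in> parcs G"
      using G nl dist cherryD(1)[OF ch(1)] cherryD(1)[OF ch(2)]
      unfolding two_center_clique_iff by auto
    then show False using l dist unfolding leaf_def by auto
  qed
  then show ?thesis
    using l cherryD(7,8)[OF ch(1)] cherryD(7,8)[OF ch(2)] unfolding leaf_def by auto
qed

text \<open>Joining the leaf \<open>p\<close> to another vertex destroys the cherry at \<open>x\<close>; Dominator then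
  destroys the one at \<open>y\<close> by selecting \<open>y\<close>.\<close>

lemma two_center_clique_add_edge:
  assumes G: "two_center_clique G x y a b c d" and p: "p \<in> {u, v}" "p \<in> {a, b}"
    and uv: "u \<in> pverts G" "v \<in> pverts G" "u \<noteq> v" "(u, v) \<notin> parcs G"
  shows "\<not> staller_wins_within (add_edge G u v) Dominator 2"
proof -
  interpret H: pair_graph "add_edge G u v" by (rule pair_graph_add_edge[OF uv(1-3)])
  have noiso: "\<not> isolated (add_edge G u v) z" for z
    using two_center_clique_not_isolated[OF G] isolated_add_edge by blast
  \<comment> \<open>No vertex was isolated, so no leaf is new; a cherry away from \<open>y\<close>
    would use both \<open>a\<close> and \<open>b\<close>, but one of them is
    \<open>p\<close>.\<close>
  have "z = y" if ch: "cherry (add_edge G u v) z e f" for z e f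
  proof (rule ccontr)
    assume "z \<noteq> y"
    have "leaf G e z" "leaf G f z" "e \<noteq> f" "e \<notin> {u, v}" "f \<notin> {u, v}"
      using ch leaf_add_edge[OF uv] two_center_clique_not_isolated[OF G]
      unfolding cherry_def by blast+
    then show False
      using two_center_clique_leaf[OF G, of e z] two_center_clique_leaf[OF G, of f z] \<open>z \<noteq> y\<close> p
      by blast
  qed
  moreover have "y \<in> pverts (add_edge G u v)"
    using G by (simp add: two_center_clique_def add_edge_def)
  ultimately show ?thesis unfolding H.staller_wins_D_two_iff using noiso by blast
qed

lemma two_center_clique_critical_D:
  assumes G: "two_center_clique G x y a b c d"
  shows "critical gamma_SMB 2 G"
proof -
  have ch: "cherry G x a b" "cherry G y c d" using G unfolding two_center_clique_iff by blast+
  have dist: "distinct [x, y, a, b, c, d]" using G unfolding two_center_clique_def by blast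
  have "staller_wins_within G Dominator 2"
    unfolding staller_wins_D_two_iff using ch cherryD(1)[OF ch(1)] dist by (auto; metis)
  moreover have "\<not> staller_wins_within G Dominator 1"
    unfolding staller_wins_D_one_iff using two_center_clique_not_isolated[OF G] by blast
  moreover have "\<not> staller_wins_within (add_edge G u v) Dominator 2"
    if uv: "u \<in> pverts G" "v \<in> pverts G" "u \<noteq> v" "(u, v) \<notin> parcs G" for u v
  proof -
    \<comment> \<open>A missing edge cannot lie inside the clique, so it ends at a leaf; the swapped
      form covers \<open>c\<close> and \<open>d\<close>.\<close>
    have "\<exists>p \<in> {u, v}. p \<in> {a, b} \<or> p \<in> {c, d}"
      using G uv unfolding two_center_clique_iff by blast
    then show ?thesis
      using two_center_clique_add_edge[OF G _ _ uv]
        two_center_clique_add_edge[OF two_center_clique_swap[OF G] _ _ uv] by blast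
  qed
  ultimately show ?thesis unfolding gamma_SMB_def critical_two_iff by blast
qed

end

section \<open>Isomorphisms\<close>

text \<open>An isomorphism carries separate maps for vertices and arcs; since arcs are the pairs of
  their ends, the vertex map determines the rest.\<close>

lemma digraph_iso_with_proj_iff:
  assumes G: "pair_wf_digraph G" and H: "pair_wf_digraph H"
  shows "digraph_iso (with_proj G) (with_proj H) \<longleftrightarrow> (\<exists>f. bij_betw f (pverts G) (pverts H) \<and>
    (\<forall>u \<in> pverts G. \<forall>v \<in> pverts G. (u, v) \<in> parcs G \<longleftrightarrow> (f u, f v) \<in> parcs H))"
    (is "_ \<longleftrightarrow> (\<exists>f. ?iso f)")
proof
  assume "digraph_iso (with_proj G) (with_proj H)"
  then obtain h where h: "pre_digraph.digraph_isomorphism (with_proj G) h"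
    and H_eq: "with_proj H = app_iso h (with_proj G)"
    unfolding digraph_iso_def by blast
  let ?f = "iso_verts h"
  have V: "pverts H = ?f ` pverts G" and E: "parcs H = iso_arcs h ` parcs G"
    and tl: "fst = iso_tail h" and hd: "snd = iso_head h"
    using arg_cong[OF H_eq, of verts] arg_cong[OF H_eq, of arcs] arg_cong[OF H_eq, of tail]
      arg_cong[OF H_eq, of head] by simp_all
  have inj: "inj_on ?f (pverts G)"
    and ends: "\<And>a. a \<in> parcs G \<Longrightarrow> ?f (fst a) = iso_tail h (iso_arcs h a) \<and>
      ?f (snd a) = iso_head h (iso_arcs h a)"
    using h unfolding pre_digraph.digraph_isomorphism_def by auto
  \<comment> \<open>Tail and head in \<open>H\<close> are again the projections, so the image of an
    arc is the pair of the images of its ends.\<close>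
  have arc: "iso_arcs h (u, v) = (?f u, ?f v)" if "(u, v) \<in> parcs G" for u v
    using ends[OF that] unfolding tl[symmetric] hd[symmetric] by (simp add: prod_eq_iff)
  have "(u, v) \<in> parcs G" if uv: "u \<in> pverts G" "v \<in> pverts G" "(?f u, ?f v) \<in> parcs H" for u v
  proof -
    obtain u' v' where "(u', v') \<in> parcs G" "(?f u, ?f v) = iso_arcs h (u', v')"
      using uv(3) unfolding E by auto
    moreover from this have "u' \<in> pverts G" "v' \<in> pverts G"
      using pair_wf_digraph.wellformed'[OF G] by blast+
    ultimately have "?f u = ?f u'" "?f v = ?f v'" "(u', v') \<in> parcs G" using arc by auto
    then show ?thesis
      using inj_onD[OF inj] uv \<open>u' \<in> pverts G\<close> \<open>v' \<in> pverts G\<close> by metis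
  qed
  moreover have "(?f u, ?f v) \<in> parcs H" if "(u, v) \<in> parcs G" for u v
    using that arc[OF that] unfolding E by force
  ultimately have "?iso ?f" using V inj unfolding bij_betw_def by blast
  then show "\<exists>f. ?iso f" by blast
next
  assume "\<exists>f. ?iso f"
  then obtain f where f: "?iso f" by blast
  let ?h = "\<lparr>iso_verts = f, iso_arcs = map_prod f f, iso_head = snd, iso_tail = fst\<rparr>"
  have inj: "inj_on f (pverts G)" and V: "pverts H = f ` pverts G"
    using f unfolding bij_betw_def by auto
  have "parcs G \<subseteq> pverts G \<times> pverts G"
    using pair_wf_digraph.wellformed'[OF G] by auto
  then have "inj_on (map_prod f f) (parcs G)"
    using map_prod_inj_on[OF inj inj] inj_on_subset by blast
  then have "pre_digraph.digraph_isomorphism (with_proj G) ?h"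
    using G inj unfolding pre_digraph.digraph_isomorphism_def wf_digraph_wp_iff by auto
  moreover have "parcs H = map_prod f f ` parcs G"
  proof (intro equalityI subrelI)
    fix u v assume uv: "(u, v) \<in> parcs H"
    then have "u \<in> f ` pverts G" "v \<in> f ` pverts G"
      using pair_wf_digraph.wellformed'[OF H] V by auto
    then show "(u, v) \<in> map_prod f f ` parcs G" using f uv by force
  next
    fix u v assume "(u, v) \<in> map_prod f f ` parcs G"
    then obtain u' v' where "(u', v') \<in> parcs G" "u = f u'" "v = f v'" by auto
    then show "(u, v) \<in> parcs H" using f pair_wf_digraph.wellformed'[OF G] by blast
  qed
  ultimately show "digraph_iso (with_proj G) (with_proj H)"
    unfolding digraph_iso_def
    by (intro exI[of _ ?h]) (auto simp: with_proj_def app_iso_def V)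
qed

text \<open>\<open>L\<close> and \<open>R\<close> determine all arcs, so a bijection is an
  isomorphism exactly if it carries the description over. It runs from the model \<open>H\<close> to
  \<open>G\<close>, so that the images of named model vertices become the special vertices of
  \<open>G\<close>.\<close>

lemma digraph_iso_clique_with_pendants_iff:
  assumes G: "pair_wf_digraph G" and H: "pair_wf_digraph H"
    and L: "L \<subseteq> pverts H" and R: "R \<subseteq> pverts H \<times> pverts H"
    and shape: "clique_with_pendants H L R"
  shows "digraph_iso (with_proj G) (with_proj H) \<longleftrightarrow>
    (\<exists>g. bij_betw g (pverts H) (pverts G) \<and> clique_with_pendants G (g ` L) (map_prod g g ` R))"
proof -
  have "(\<forall>u \<in> pverts H. \<forall>v \<in> pverts H. (u, v) \<in> parcs H \<longleftrightarrow> (g u, g v) \<in> parcs G) \<longleftrightarrow>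
      clique_with_pendants G (g ` L) (map_prod g g ` R)"
    if g: "bij_betw g (pverts H) (pverts G)" for g
  proof -
    have inj: "inj_on g (pverts H)" and V: "pverts G = g ` pverts H"
      using g unfolding bij_betw_def by auto
    have mem: "g u \<in> g ` L \<longleftrightarrow> u \<in> L" if "u \<in> pverts H" for u
      using inj_on_image_mem_iff[OF inj that L] .
    have pair: "(g u, g v) \<in> map_prod g g ` R \<longleftrightarrow> (u, v) \<in> R"
      if "u \<in> pverts H" "v \<in> pverts H" for u v
      using inj_on_image_mem_iff[OF map_prod_inj_on[OF inj inj] _ R, of "(u, v)"] that by simp
    show ?thesis
      using shape unfolding clique_with_pendants_def V
      by (simp add: mem pair inj_on_eq_iff[OF inj]) blast
  qed
  moreover have "digraph_iso (with_proj G) (with_proj H) \<longleftrightarrow> digraph_iso (with_proj H) (with_proj G)"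
    using digraph_iso_swap wf_digraph_wp_iff G H by metis
  ultimately show ?thesis
    unfolding digraph_iso_with_proj_iff[OF H G] by blast
qed

text \<open>This sends the named vertices of a model graph to prescribed vertices of
  \<open>G\<close>; the other clique vertices may be matched arbitrarily.\<close>

lemma bij_betw_extending_lists:
  assumes "length xs = length ys" "finite A" "finite B" "card A = card B"
    "distinct xs" "distinct ys" "set xs \<subseteq> A" "set ys \<subseteq> B"
  shows "\<exists>f. bij_betw f A B \<and> map f xs = ys"
  using assms
proof (induction xs ys arbitrary: A B rule: list_induct2)
  case Nil
  then show ?case using finite_same_card_bij by auto
next
  case (Cons x xs y ys)
  have "\<exists>f. bij_betw f (A - {x}) (B - {y}) \<and> map f xs = ys"
    using Cons.prems by (intro Cons.IH) auto
  then obtain f where f: "bij_betw f (A - {x}) (B - {y})" "map f xs = ys" by blast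
  have "x \<notin> set xs" using Cons.prems by simp
  have "bij_betw (f(x := y)) (A - {x}) (B - {y})"
    using f(1) by (subst bij_betw_cong[of _ _ f]) auto
  moreover have "bij_betw (f(x := y)) {x} {y}" by (simp add: bij_betw_def)
  ultimately have "bij_betw (f(x := y)) (A - {x} \<union> {x}) (B - {y} \<union> {y})"
    by (rule bij_betw_combine) simp
  then have "bij_betw (f(x := y)) A B"
    using Cons.prems by (simp add: insert_absorb)
  moreover have "map (f(x := y)) (x # xs) = y # ys"
    using f(2) \<open>x \<notin> set xs\<close> by simp
  ultimately show ?case by (intro exI[of _ "f(x := y)"] conjI)
qed

section \<open>Matching with the concrete families of graphs\<close>

lemma distinct_map_bij_betw:
  assumes "bij_betw f A B" "distinct xs" "set xs \<subseteq> A"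
  shows "distinct (map f xs)" "set (map f xs) \<subseteq> B"
  using assms unfolding distinct_map bij_betw_def by (auto intro: inj_on_subset)

lemma digraph_iso_graph_one_center_iff:
  assumes "pair_graph G"
  shows "(\<exists>n \<ge> 1. digraph_iso (with_proj G) (with_proj (graph_one_center n))) \<longleftrightarrow>
    (\<exists>x a b. one_center_clique G {} x a b)"
proof -
  interpret pair_graph G by fact
  have V: "pverts (graph_one_center n) = {..<n + 2}" for n
    by (auto simp: graph_one_center_def attach_pendant_def complete_graph_def)
  \<comment> \<open>In the model \<open>0\<close> is the centre, and \<open>n\<close> and
    \<open>n + 1\<close> are its pendant vertices.\<close>
  have iso: "digraph_iso (with_proj G) (with_proj (graph_one_center n)) \<longleftrightarrow>
      (\<exists>g. bij_betw g {..<n + 2} (pverts G) \<and>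
        clique_with_pendants G {g n, g (n + 1)} {(g n, g 0), (g (n + 1), g 0)})" if "n \<ge> 1" for n
  proof -
    have "pair_wf_digraph (graph_one_center n)"
      using that by unfold_locales
        (auto simp: graph_one_center_def attach_pendant_def complete_graph_def)
    moreover have "clique_with_pendants (graph_one_center n) {n, n + 1} {(n, 0), (n + 1, 0)}"
      using that unfolding clique_with_pendants_def
      by (auto simp: graph_one_center_def attach_pendant_def complete_graph_def)
    ultimately show ?thesis
      using digraph_iso_clique_with_pendants_iff[OF pair_wf_digraph, of "graph_one_center n"
        "{n, n + 1}" "{(n, 0), (n + 1, 0)}"] that by (simp add: V)
  qed
  show ?thesis
  proof
    assume "\<exists>n \<ge> 1. digraph_iso (with_proj G) (with_proj (graph_one_center n))"
    then obtain n where n: "n \<ge> 1" and "digraph_iso (with_proj G) (with_proj (graph_one_center n))"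
      by blast
    then obtain g where g: "bij_betw g {..<n + 2} (pverts G)"
      "clique_with_pendants G {g n, g (n + 1)} {(g n, g 0), (g (n + 1), g 0)}"
      using iso[OF n] by blast
    have "distinct (map g [0, n, n + 1])" "set (map g [0, n, n + 1]) \<subseteq> pverts G"
      using n by (intro distinct_map_bij_betw[OF g(1)]; auto)+
    then have "one_center_clique G {} (g 0) (g n) (g (n + 1))"
      using g(2) unfolding one_center_clique_def by simp
    then show "\<exists>x a b. one_center_clique G {} x a b" by blast
  next
    assume "\<exists>x a b. one_center_clique G {} x a b"
    then obtain x a b where G: "one_center_clique G {} x a b" by blast
    \<comment> \<open>All vertices but \<open>a\<close> and \<open>b\<close> form the clique; since
      \<open>x\<close> is one of them, \<open>n \<ge> 1\<close>.\<close>
    define n where "n = card (pverts G) - 2"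
    have sub: "set [x, a, b] \<subseteq> pverts G" and dist: "distinct [x, a, b]"
      using G unfolding one_center_clique_def by auto
    have "3 \<le> card (pverts G)"
      using card_mono[OF pair_finite_verts sub] distinct_card[OF dist] by simp
    then have n: "n \<ge> 1" "card (pverts G) = n + 2" by (auto simp: n_def)
    have "\<exists>g. bij_betw g {..<n + 2} (pverts G) \<and> map g [0, n, n + 1] = [x, a, b]"
      using n sub dist pair_finite_verts by (intro bij_betw_extending_lists) auto
    then have "digraph_iso (with_proj G) (with_proj (graph_one_center n))"
      using G unfolding iso[OF n(1)] one_center_clique_def by auto
    then show "\<exists>n \<ge> 1. digraph_iso (with_proj G) (with_proj (graph_one_center n))"
      using n by blast
  qed
qed

lemma digraph_iso_graph_one_center_union_iff:
  assumes "pair_graph G"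
  shows "(\<exists>n \<ge> 1. digraph_iso (with_proj G)
      (with_proj (disjoint_union (graph_one_center n) (complete_graph 1)))) \<longleftrightarrow>
    (\<exists>w x a b. one_center_clique G {w} x a b)"
proof -
  interpret pair_graph G by fact
  let ?H = "\<lambda>n. disjoint_union (graph_one_center n) (complete_graph 1)"
  have V: "pverts (?H n) = {..<n + 2} <+> {..<1::nat}" for n
    by (auto simp: disjoint_union_def graph_one_center_def attach_pendant_def complete_graph_def)
  \<comment> \<open>\<open>Inr 0\<close> is the added isolated vertex; the other labels are those of
    the one-centre model.\<close>
  have iso: "digraph_iso (with_proj G) (with_proj (?H n)) \<longleftrightarrow>
      (\<exists>g. bij_betw g ({..<n + 2} <+> {..<1::nat}) (pverts G) \<and>
        clique_with_pendants G {g (Inl n), g (Inl (n + 1)), g (Inr 0)}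
          {(g (Inl n), g (Inl 0)), (g (Inl (n + 1)), g (Inl 0))})" if "n \<ge> 1" for n
  proof -
    have "pair_wf_digraph (?H n)"
      using that by unfold_locales
        (auto simp: disjoint_union_def graph_one_center_def attach_pendant_def complete_graph_def)
    moreover have "clique_with_pendants (?H n) {Inl n, Inl (n + 1), Inr 0}
        {(Inl n, Inl 0), (Inl (n + 1), Inl 0)}"
      using that unfolding clique_with_pendants_def
      by (auto simp: disjoint_union_def graph_one_center_def attach_pendant_def
          complete_graph_def image_iff)
    ultimately show ?thesis
      using digraph_iso_clique_with_pendants_iff[OF pair_wf_digraph, of "?H n"
        "{Inl n, Inl (n + 1), Inr 0}" "{(Inl n, Inl 0), (Inl (n + 1), Inl 0)}"] that
      by (simp add: V InlI InrI del: One_nat_def)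
  qed
  show ?thesis
  proof
    assume "\<exists>n \<ge> 1. digraph_iso (with_proj G) (with_proj (?H n))"
    then obtain n where n: "n \<ge> 1" and "digraph_iso (with_proj G) (with_proj (?H n))"
      by blast
    then obtain g where g: "bij_betw g ({..<n + 2} <+> {..<1::nat}) (pverts G)"
      "clique_with_pendants G {g (Inl n), g (Inl (n + 1)), g (Inr 0)}
          {(g (Inl n), g (Inl 0)), (g (Inl (n + 1)), g (Inl 0))}"
      using iso[OF n] by blast
    let ?ys = "[Inl 0, Inl n, Inl (n + 1), Inr 0]"
    have "distinct (map g ?ys)" "set (map g ?ys) \<subseteq> pverts G"
      using n by (intro distinct_map_bij_betw[OF g(1)]; auto)+
    then have "one_center_clique G {g (Inr 0)} (g (Inl 0)) (g (Inl n)) (g (Inl (n + 1)))"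
      using g(2) unfolding one_center_clique_def by (simp add: insert_commute)
    then show "\<exists>w x a b. one_center_clique G {w} x a b" by blast
  next
    assume "\<exists>w x a b. one_center_clique G {w} x a b"
    then obtain w x a b where G: "one_center_clique G {w} x a b" by blast
    \<comment> \<open>The vertices \<open>a\<close>, \<open>b\<close> and \<open>w\<close> lie
      outside the clique.\<close>
    define n where "n = card (pverts G) - 3"
    have sub: "set [x, a, b, w] \<subseteq> pverts G" and dist: "distinct [x, a, b, w]"
      using G unfolding one_center_clique_def by auto
    have "4 \<le> card (pverts G)"
      using card_mono[OF pair_finite_verts sub] distinct_card[OF dist] by simp
    then have n: "n \<ge> 1" "card (pverts G) = n + 3" by (auto simp: n_def)
    have "\<exists>g. bij_betw g ({..<n + 2} <+> {..<1::nat}) (pverts G) \<and>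
        map g [Inl 0, Inl n, Inl (n + 1), Inr 0] = [x, a, b, w]"
      using n sub dist pair_finite_verts
      by (intro bij_betw_extending_lists) (auto simp: card_Plus)
    then have "digraph_iso (with_proj G) (with_proj (?H n))"
      using G unfolding iso[OF n(1)] one_center_clique_def by (auto simp: insert_commute)
    then show "\<exists>n \<ge> 1. digraph_iso (with_proj G) (with_proj (?H n))"
      using n by blast
  qed
qed

lemma digraph_iso_graph_two_centers_iff:
  assumes "pair_graph G"
  shows "(\<exists>n \<ge> 2. digraph_iso (with_proj G) (with_proj (graph_two_centers n))) \<longleftrightarrow>
    (\<exists>x y a b c d. two_center_clique G x y a b c d)"
proof -
  interpret pair_graph G by fact
  have V: "pverts (graph_two_centers n) = {..<n + 4}" for n
    by (auto simp: graph_two_centers_def attach_pendant_def complete_graph_def)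
  \<comment> \<open>The centres are \<open>0\<close> and \<open>1\<close>, which lie in the clique
    because \<open>n \<ge> 2\<close>; the four pendant vertices are numbered from \<open>n\<close>
    on, two for each centre.\<close>
  have iso: "digraph_iso (with_proj G) (with_proj (graph_two_centers n)) \<longleftrightarrow>
      (\<exists>g. bij_betw g {..<n + 4} (pverts G) \<and>
        clique_with_pendants G {g n, g (n + 1), g (n + 2), g (n + 3)}
          {(g n, g 0), (g (n + 1), g 0), (g (n + 2), g 1), (g (n + 3), g 1)})" if "n \<ge> 2" for n
  proof -
    have "pair_wf_digraph (graph_two_centers n)"
      using that by unfold_locales
        (auto simp: graph_two_centers_def attach_pendant_def complete_graph_def)
    moreover have "clique_with_pendants (graph_two_centers n) {n, n + 1, n + 2, n + 3}
        {(n, 0), (n + 1, 0), (n + 2, 1), (n + 3, 1)}"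
      using that unfolding clique_with_pendants_def
      by (auto simp: graph_two_centers_def attach_pendant_def complete_graph_def)
    ultimately show ?thesis
      using digraph_iso_clique_with_pendants_iff[OF pair_wf_digraph, of "graph_two_centers n"
        "{n, n + 1, n + 2, n + 3}" "{(n, 0), (n + 1, 0), (n + 2, 1), (n + 3, 1)}"] that
      by (simp add: V)
  qed
  show ?thesis
  proof
    assume "\<exists>n \<ge> 2. digraph_iso (with_proj G) (with_proj (graph_two_centers n))"
    then obtain n where n: "n \<ge> 2" and "digraph_iso (with_proj G) (with_proj (graph_two_centers n))"
      by blast
    then obtain g where g: "bij_betw g {..<n + 4} (pverts G)"
      "clique_with_pendants G {g n, g (n + 1), g (n + 2), g (n + 3)}
          {(g n, g 0), (g (n + 1), g 0), (g (n + 2), g 1), (g (n + 3), g 1)}"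
      using iso[OF n] by blast
    let ?ys = "[0, 1, n, n + 1, n + 2, n + 3]"
    have "distinct (map g ?ys)" "set (map g ?ys) \<subseteq> pverts G"
      using n by (intro distinct_map_bij_betw[OF g(1)]; auto)+
    then have "two_center_clique G (g 0) (g 1) (g n) (g (n + 1)) (g (n + 2)) (g (n + 3))"
      using g(2) unfolding two_center_clique_def by simp
    then show "\<exists>x y a b c d. two_center_clique G x y a b c d" by blast
  next
    assume "\<exists>x y a b c d. two_center_clique G x y a b c d"
    then obtain x y a b c d where G: "two_center_clique G x y a b c d" by blast
    \<comment> \<open>Four vertices are pendant, and the two centres remain in the clique, whence
      \<open>n \<ge> 2\<close>.\<close>
    define n where "n = card (pverts G) - 4"
    have sub: "set [x, y, a, b, c, d] \<subseteq> pverts G" and dist: "distinct [x, y, a, b, c, d]"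
      using G unfolding two_center_clique_def by auto
    have "6 \<le> card (pverts G)"
      using card_mono[OF pair_finite_verts sub] distinct_card[OF dist] by simp
    then have n: "n \<ge> 2" "card (pverts G) = n + 4" by (auto simp: n_def)
    have "\<exists>g. bij_betw g {..<n + 4} (pverts G) \<and>
        map g [0, 1, n, n + 1, n + 2, n + 3] = [x, y, a, b, c, d]"
      using n sub dist pair_finite_verts by (intro bij_betw_extending_lists) auto
    then have "digraph_iso (with_proj G) (with_proj (graph_two_centers n))"
      using G unfolding iso[OF n(1)] two_center_clique_def by auto
    then show "\<exists>n \<ge> 2. digraph_iso (with_proj G) (with_proj (graph_two_centers n))"
      using n by blast
  qed
qed

theorem theorem5p3:
  fixes G :: "'a pair_pre_digraph"
  assumes "pair_graph G"
  shows "(critical gamma_SMB 2 G \<longleftrightarrow>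
            (\<exists>n \<ge> 1. digraph_iso (with_proj G)
                (with_proj (disjoint_union (graph_one_center n) (complete_graph 1)))) \<or>
            (\<exists>n \<ge> 2. digraph_iso (with_proj G) (with_proj (graph_two_centers n)))) \<and>
         (critical gamma_SMB' 2 G \<longleftrightarrow>
            (\<exists>n \<ge> 1. digraph_iso (with_proj G) (with_proj (graph_one_center n))))"
proof -
  interpret pair_graph G by fact
  show ?thesis
    unfolding digraph_iso_graph_one_center_iff[OF assms] digraph_iso_graph_two_centers_iff[OF assms]
      digraph_iso_graph_one_center_union_iff[OF assms] critical_S_iff
    using critical_D_imp one_center_clique_critical_D two_center_clique_critical_D by blast
qed

end
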